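(* There exist absolute constants $C>c>0$ such that for every $L>0$, the Robin–Neumann gaps of the rectangle $[0,1]\times[0,L]$ satisfy $$d_j(\sigma)\le C\cdot\overline d(\sigma)\quad\text{for all }\sigma>0\text{ and all }j\ge1,$$ and $$d_j(\sigma)\ge c\cdot\overline d(\sigma)\quad\text{for all }\sigma\in(0,1]\text{ and all }j\ge1.$$
   Context: For an integer $n\ge 0$ and $\sigma>0$, $k_n(\sigma)$ denotes the unique solution $k\in(n\pi,(n+1)\pi)$ of the secular equation $\tan(k)=\frac{2\sigma k}{k^2-\sigma^2}$ (read in cross-multiplied form, $(k^2-\sigma^2)\sin k=2\sigma k\cos k$, when $k=\sigma$); set $k_n(0)=n\pi$. The Robin eigenvalues of the rectangle $[0,1]\times[0,L]$ (i.e. of $-\Delta f=\lambda f$ with $\frac{\partial f}{\partial n}+\sigma f=0$ on the boundary, $\frac{\partial}{\partial n}$ being the outward normal derivative; $\sigma=0$ is the Neumann case) are $\Lambda_{L;n,m}(\sigma)=k_n(\sigma)^2+\frac1{L^2}k_m(\sigma L)^2$, $n,m\ge 0$. Let $\lambda_1(\sigma)\le\lambda_2(\sigma)\le\dots$ be these numbers in increasing order, with multiplicities. The Robin–Neumann gaps are $d_j(\sigma)=\lambda_j(\sigma)-\lambda_j(0)$, and their limiting mean is $$\overline d(\sigma)=\lim_{N\to\infty}\frac1N\sum_{j=1}^N d_j(\sigma)=\frac{2\,\mathrm{length}(\partial([0,1]\times[0,L]))}{\mathrm{Area}([0,1]\times[0,L])}\,\sigma=\frac{4(1+L)}{L}\,\sigma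 .$$ *)

theory Defs imports Complex_Main
begin

text \<open>
  The secular equation, cross-multiplied only at its pole k = s.  At a zero of cos, where
  HOL sets tan k = 0, the equation fails for positive k, s with k different from s, since
  the right-hand side is then nonzero.
\<close>

definition secular :: "real \<Rightarrow> real \<Rightarrow> bool" where
  "secular s k \<longleftrightarrow>
     (if k = s then (k\<^sup>2 - s\<^sup>2) * sin k = 2 * s * k * cos k
      else tan k = 2 * s * k / (k\<^sup>2 - s\<^sup>2))"

definition robin_k :: "nat \<Rightarrow> real \<Rightarrow> real" where
  "robin_k n s =
     (if s = 0 then real n * pi
      else (THE k. real n * pi < k \<and> k < (real n + 1) * pi \<and> secular s k))"

definition Lambda :: "real \<Rightarrow> nat \<times> nat \<Rightarrow> real \<Rightarrow> real" where
  "Lambda L p s = (case p of (n, m) \<Rightarrow> (robin_k n s)\<^sup>2 + 1 / L\<^sup>2 * (robin_k m (s * L))\<^sup>2)"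

text \<open>
  Listing the eigenvalues in increasing order with multiplicities means listing all index
  pairs (n, m) exactly once, along 1, 2, 3, ..., with nondecreasing values.  Two such
  listings differ only in how they order pairs of equal value, so the eigenvalue at
  position j does not depend on the choice.
\<close>

definition increasing_listing :: "(nat \<times> nat \<Rightarrow> real) \<Rightarrow> (nat \<Rightarrow> nat \<times> nat) \<Rightarrow> bool" where
  "increasing_listing F e \<longleftrightarrow> bij_betw e {1..} UNIV \<and> mono_on {1..} (\<lambda>j. F (e j))"

definition robin_eigenvalue :: "real \<Rightarrow> nat \<Rightarrow> real \<Rightarrow> real" where
  "robin_eigenvalue L j s =
     Lambda L ((SOME e. increasing_listing (\<lambda>p. Lambda L p s) e) j) s"

definition RN_gap :: "real \<Rightarrow> nat \<Rightarrow> real \<Rightarrow> real" where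
  "RN_gap L j s = robin_eigenvalue L j s - robin_eigenvalue L j 0"

definition mean_RN_gap :: "real \<Rightarrow> real \<Rightarrow> real" where
  "mean_RN_gap L s = lim (\<lambda>N. 1 / real N * (\<Sum>j=1..N. RN_gap L j s))"

end

theory Submission imports Defs "HOL-Analysis.Complex_Transcendental" "HOL-Real_Asymp.Real_Asymp"
begin

text \<open>
  For \<open>k > 0\<close> the secular equation says that \<open>(k + i s)\<^sup>2\<close> has argument \<open>k\<close> modulo \<open>\<pi>\<close>, so on
  \<open>(n\<pi>, (n+1)\<pi>)\<close> it is equivalent to \<open>k - 2 arctan (s/k) = n\<pi>\<close>.  Hence the one-dimensional gap
  \<open>k\<^sub>n(s)\<^sup>2 - (n\<pi>)\<^sup>2 = 2 arctan (s/k) (k + n\<pi>)\<close> is at most \<open>4s\<close>, tends to \<open>4s\<close> as \<open>n\<close> grows, and is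
  at least \<open>s\<close> if \<open>s \<le> 1\<close>.  Moving each index pair from \<open>0\<close> to \<open>\<sigma>\<close> therefore raises its
  eigenvalue by at most \<open>4\<sigma> + 4\<sigma>L/L\<^sup>2 = 4(1+L)\<sigma>/L\<close>.  For \<open>\<sigma> \<le> 1\<close> it raises it by at least \<open>\<sigma>\<close>
  (horizontal part), and by at least \<open>\<sigma>L/L\<^sup>2 = \<sigma>/L\<close> (vertical part) if \<open>L \<le> 1\<close>; the larger
  of these is at least an eighth of \<open>4(1+L)\<sigma>/L\<close>.  A uniform bound for each index pair passes to
  the sorted eigenvalues (\<open>increasing_listing_compare\<close>), so the two inequalities hold with
  \<open>C = 1\<close> and \<open>c = 1/8\<close> once the mean gap is known to be \<open>4(1+L)\<sigma>/L\<close>.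

  The mean is at most this number by the pointwise bound.  For the other direction, the sum of
  the first \<open>N\<close> Neumann eigenvalues is at most the sum of the Neumann values over any \<open>N\<close> index
  pairs, in particular over the \<open>N\<close> pairs that come first in the Robin ordering.  So
  \<open>\<Sum>\<^sub>j d\<^sub>j(\<sigma>)\<close> is at least the sum of the index-wise gaps over those pairs
  (\<open>sum_RN_gap_ge\<close>).  The index-wise gap is close to \<open>4(1+L)\<sigma>/L\<close> except in finitely many rows
  and columns, and any fixed row or column has density zero among the first \<open>N\<close> pairs
  (\<open>column_density_zero\<close>).  This needs only the crude quadratic growth of the
  \<open>k\<^sub>n(s)\<^sup>2\<close>, not the asymptotics of the eigenvalue counting function.
\<close>

section \<open>Increasing listings\<close>

text \<open>
  The listing always takes a minimiser of \<open>F\<close> among the pairs not taken so far.  It misses no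
  pair \<open>p\<close>, since otherwise infinitely many pairs would lie in the finite sublevel set at \<open>F p\<close>.
\<close>

lemma increasing_listing_exists:
  assumes fin: "\<And>R. finite {p. F p \<le> R}"
  shows "\<exists>e. increasing_listing F e"
proof -
  define P where "P f j p \<longleftrightarrow> p \<notin> f ` {..<j} \<and> (\<forall>q. q \<notin> f ` {..<j} \<longrightarrow> F p \<le> F q)"
    for f :: "nat \<Rightarrow> nat \<times> nat" and j p
  have "\<exists>f. \<forall>j. P f j (f j)"
  proof (rule dependent_wellorder_choice)
    fix r :: "nat \<times> nat" and f g :: "nat \<Rightarrow> nat \<times> nat" and j :: nat
    assume "\<And>i. i < j \<Longrightarrow> f i = g i"
    then have "f ` {..<j} = g ` {..<j}" by (intro image_cong) auto
    then show "P f j r = P g j r" unfolding P_def by simp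
  next
    fix j :: nat and f :: "nat \<Rightarrow> nat \<times> nat"
    have "infinite (UNIV :: (nat \<times> nat) set)" by (simp add: finite_prod)
    then obtain q where q: "q \<notin> f ` {..<j}" by (meson ex_new_if_finite finite_imageI finite_lessThan)
    define S where "S = {p. F p \<le> F q} - f ` {..<j}"
    have S: "finite S" "S \<noteq> {}" using fin q unfolding S_def by auto
    define r where "r = arg_min_on F S"
    have r: "r \<in> S" unfolding r_def using S by (rule arg_min_if_finite)
    have "F r \<le> F p" if "p \<notin> f ` {..<j}" for p
    proof (cases "F p \<le> F q")
      case True
      then show ?thesis using that S unfolding r_def by (intro arg_min_least) (auto simp: S_def)
    next
      case False
      then show ?thesis using r unfolding S_def by simp
    qed
    then have "P f j r" using r unfolding P_def S_def by simp
    then show "\<exists>r. P f j r" ..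
  qed
  then obtain f where f: "\<And>j. P f j (f j)" by blast
  have mono: "F (f i) \<le> F (f j)" if "i \<le> j" for i j
  proof -
    have "f j \<notin> f ` {..<i}" using f[of j] that unfolding P_def by auto
    then show ?thesis using f[of i] unfolding P_def by blast
  qed
  have neq: "f i \<noteq> f j" if "i < j" for i j
  proof -
    have "f j \<notin> f ` {..<j}" using f[of j] unfolding P_def by blast
    then show ?thesis using that by (metis imageI lessThan_iff)
  qed
  have inj: "inj f" by (rule injI) (metis neq linorder_neqE_nat)
  have surj: "surj f"
  proof (rule ccontr)
    assume "\<not> surj f"
    then obtain p where p: "p \<notin> range f" by auto
    have "F (f j) \<le> F p" for j
    proof -
      have "p \<notin> f ` {..<j}" using p by auto
      then show ?thesis using f[of j] unfolding P_def by blast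
    qed
    then have "range f \<subseteq> {q. F q \<le> F p}" by auto
    then have "finite (range f)" using fin by (rule finite_subset)
    then show False using inj by (simp add: finite_image_iff)
  qed
  have "bij_betw (\<lambda>j::nat. j - 1) {1..} UNIV"
    by (rule bij_betw_byWitness[where f' = Suc]) auto
  then have "bij_betw (f \<circ> (\<lambda>j. j - 1)) {1..} UNIV"
    using inj surj by (intro bij_betw_trans) (auto simp: bij_betw_def)
  then have "increasing_listing F (f \<circ> (\<lambda>j. j - 1))"
    unfolding increasing_listing_def by (auto intro!: mono_onI mono)
  then show ?thesis by blast
qed

lemma increasing_listing_inj: "increasing_listing F e \<Longrightarrow> A \<subseteq> {1..} \<Longrightarrow> inj_on e A"
  unfolding increasing_listing_def bij_betw_def by (blast intro: inj_on_subset)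

lemma increasing_listing_mono:
  "increasing_listing F e \<Longrightarrow> 1 \<le> i \<Longrightarrow> i \<le> j \<Longrightarrow> F (e i) \<le> F (e j)"
  unfolding increasing_listing_def mono_on_def by auto

lemma increasing_listing_later:
  assumes "increasing_listing F e" and "p \<notin> e ` {1..<j}" and "1 \<le> j"
  shows "F (e j) \<le> F p"
proof -
  obtain i where i: "i \<ge> 1" "p = e i"
    using assms(1) unfolding increasing_listing_def bij_betw_def by (metis UNIV_I atLeast_iff imageE)
  have "\<not> i < j" using assms(2) i by auto
  then show ?thesis using increasing_listing_mono[OF assms(1), of j i] i assms(3) by simp
qed

text \<open>
  The first \<open>j\<close> pairs in the order of \<open>G\<close> cannot all be among the first \<open>j - 1\<close> in the order of
  \<open>F\<close>; a pair that is not has \<open>F\<close>-value at least \<open>F (e j)\<close> and \<open>G\<close>-value at most \<open>G (e' j)\<close>.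
  This plays the role of the min-max principle.
\<close>

lemma increasing_listing_compare:
  assumes F: "increasing_listing F e" and G: "increasing_listing G e'"
    and le: "\<And>p. F p + d \<le> G p" and j: "1 \<le> j"
  shows "F (e j) + d \<le> G (e' j)"
proof -
  have "card (e ` {1..<j}) \<le> j - 1" using card_image_le[of "{1..<j}" e] by simp
  moreover have "card (e' ` {1..j}) = j"
    using card_image[OF increasing_listing_inj[OF G, of "{1..j}"]] by auto
  ultimately have "\<not> e' ` {1..j} \<subseteq> e ` {1..<j}"
    using card_mono[of "e ` {1..<j}" "e' ` {1..j}"] j by auto
  then obtain p where p: "p \<in> e' ` {1..j}" "p \<notin> e ` {1..<j}" by blast
  then obtain i where i: "1 \<le> i" "i \<le> j" "e' i \<notin> e ` {1..<j}" by (metis atLeastAtMost_iff imageE)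
  have "F (e j) \<le> F (e' i)" using increasing_listing_later[OF F i(3) j] .
  also have "\<dots> \<le> G (e' i) - d" using le[of "e' i"] by simp
  also have "\<dots> \<le> G (e' j) - d" using increasing_listing_mono[OF G i(1,2)] by simp
  finally show ?thesis by simp
qed

text \<open>
  Exchange argument: the pairs in which \<open>S\<close> and the first \<open>N\<close> pairs differ are equally many on
  both sides, and \<open>F (e N)\<close> separates their values.
\<close>

lemma increasing_listing_sum_le:
  assumes e: "increasing_listing F e" and S: "finite S" "card S = N"
  shows "(\<Sum>j=1..N. F (e j)) \<le> sum F S"
proof (cases "N = 0")
  case False
  define A where "A = e ` {1..N}"
  have inj: "inj_on e {1..N}" by (rule increasing_listing_inj[OF e]) auto
  have A: "finite A" "card A = N" unfolding A_def using card_image[OF inj] by auto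
  have lo: "F p \<le> F (e N)" if "p \<in> A - S" for p
    using that increasing_listing_mono[OF e] unfolding A_def by auto
  have hi: "F (e N) \<le> F p" if "p \<in> S - A" for p
  proof (rule increasing_listing_later[OF e])
    have "e ` {1..<N} \<subseteq> A" unfolding A_def by auto
    then show "p \<notin> e ` {1..<N}" using that by auto
  qed (use False in auto)
  have c: "card (A - S) = card (S - A)"
    using A S by (simp add: card_Diff_subset_Int Int_commute)
  have "sum F (A - S) \<le> real (card (A - S)) * F (e N)"
    using sum_bounded_above[of "A - S" F "F (e N)"] lo by simp
  also have "\<dots> \<le> sum F (S - A)"
    using sum_bounded_below[of "S - A" "F (e N)" F] hi c by simp
  finally have "sum F A \<le> sum F S"
    using sum.Int_Diff[OF A(1), of F S] sum.Int_Diff[OF S(1), of F A] by (simp add: Int_commute)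
  then show ?thesis unfolding A_def using sum.reindex[OF inj, of F] by simp
qed (use S in auto)

section \<open>Negligible rows and columns\<close>

text \<open>
  If the first \<open>N\<close> pairs contain \<open>t\<close> pairs with first coordinate \<open>n0\<close>, then one of them is
  \<open>(n0, b)\<close> with \<open>b \<ge> t - 1\<close>.  Because \<open>h b - h (b div 2)\<close> eventually exceeds every constant,
  for large \<open>t\<close> the lower halves of the first \<open>M\<close> columns all come before \<open>(n0, b)\<close>, whence
  \<open>N \<ge> M t / 2\<close>.  As \<open>M\<close> is arbitrary, \<open>t / N\<close> tends to zero.
\<close>

lemma column_density_zero:
  fixes f h :: "nat \<Rightarrow> real"
  assumes e: "increasing_listing F e" and F: "\<And>n m. F (n, m) = f n + h m"
    and h: "mono h" and growth: "filterlim (\<lambda>b. h b - h (b div 2)) at_top at_top"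
  shows "(\<lambda>N. real (card {j \<in> {1..N}. fst (e j) = n0}) / real N) \<longlonglongrightarrow> 0"
proof (rule LIMSEQ_I)
  fix r :: real assume r: "r > 0"
  obtain M :: nat where M: "real M > 4 / r" using reals_Archimedean2 by blast
  define C where "C = Max (f ` {..<M}) - f n0"
  have C: "f n - f n0 \<le> C" if "n < M" for n unfolding C_def using that by (auto intro!: Max_ge)
  obtain A where A: "\<And>b. b \<ge> A \<Longrightarrow> h b - h (b div 2) > C"
    using filterlim_at_top_dense[THEN iffD1, OF growth, rule_format, of C]
    unfolding eventually_at_top_linorder by blast
  \<comment> \<open>The strict \<open>t > A\<close> makes \<open>b \<ge> t - 1\<close> large enough for the growth condition.\<close>
  have main: "real M * real t \<le> 2 * real N" if t: "t = card {j \<in> {1..N}. fst (e j) = n0}" "t > A" for t N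
  proof -
    define T where "T = {j \<in> {1..N}. fst (e j) = n0}"
    have fT: "finite T" unfolding T_def by simp
    have "inj_on (\<lambda>j. snd (e j)) T"
    proof (rule inj_onI)
      fix i j assume ij: "i \<in> T" "j \<in> T" "snd (e i) = snd (e j)"
      then have "e i = e j" unfolding T_def by (auto simp: prod_eq_iff)
      then show "i = j" using inj_onD[OF increasing_listing_inj[OF e, of T]] ij unfolding T_def by auto
    qed
    then have cT: "card ((\<lambda>j. snd (e j)) ` T) = t" using card_image t unfolding T_def by blast
    have "\<exists>j\<in>T. t - 1 \<le> snd (e j)"
    proof (rule ccontr)
      assume "\<not> ?thesis"
      then have "(\<lambda>j. snd (e j)) ` T \<subseteq> {..<t - 1}" by auto
      then have "t \<le> t - 1" using card_mono[of "{..<t - 1}"] cT by fastforce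
      then show False using t by simp
    qed
    then obtain j where j: "j \<in> T" "t - 1 \<le> snd (e j)" by blast
    define b where "b = snd (e j)"
    have b: "b \<ge> A" "t \<le> b + 1" using j t unfolding b_def by auto
    have ej: "F (e j) = f n0 + h b" using F[of "fst (e j)" "snd (e j)"] j unfolding b_def T_def by simp
    have "{..<M} \<times> {..b div 2} \<subseteq> e ` {1..<j}"
    proof (rule ccontr)
      assume "\<not> ?thesis"
      then obtain n m where nm: "n < M" "m \<le> b div 2" "(n, m) \<notin> e ` {1..<j}" by auto
      have "F (e j) \<le> F (n, m)" using increasing_listing_later[OF e nm(3)] j unfolding T_def by auto
      moreover have "h m \<le> h (b div 2)" using h nm(2) by (simp add: monoD)
      ultimately show False using ej F C[OF nm(1)] A[OF b(1)] by simp
    qed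
    then have "card ({..<M} \<times> {..b div 2}) \<le> card (e ` {1..<j})" by (intro card_mono) auto
    also have "\<dots> \<le> N" using card_image_le[of "{1..<j}" e] j unfolding T_def by auto
    finally have "M * (b div 2 + 1) \<le> N" by (simp add: card_cartesian_product)
    have "t \<le> 2 * (b div 2 + 1)" using b(2) by presburger
    then have "M * t \<le> M * (2 * (b div 2 + 1))" by (rule mult_le_mono2)
    also have "\<dots> \<le> 2 * N" using \<open>M * (b div 2 + 1) \<le> N\<close> by simp
    finally have "real (M * t) \<le> real (2 * N)" by (simp only: of_nat_le_iff)
    then show ?thesis by simp
  qed
  obtain N0 :: nat where N0: "real N0 > real A / r" using reals_Archimedean2 by blast
  show "\<exists>no. \<forall>N\<ge>no. norm (real (card {j \<in> {1..N}. fst (e j) = n0}) / real N - 0) < r"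
  proof (intro exI allI impI)
    fix N assume N: "N \<ge> max 1 N0"
    define t where "t = card {j \<in> {1..N}. fst (e j) = n0}"
    have N1: "real N > 0" using N by simp
    have "real t < r * real N"
    proof (cases "t > A")
      case True
      have "4 < r * real M" using M r by (simp add: field_simps)
      then have "4 * real t < r * real M * real t" using True by (intro mult_strict_right_mono) auto
      also have "\<dots> \<le> r * (2 * real N)" using main[OF t_def True] r by (simp add: mult.assoc)
      also have "\<dots> = 2 * (r * real N)" by simp
      finally have "4 * real t < 2 * (r * real N)" .
      moreover have "0 < r * real N" using N1 r by simp
      ultimately show ?thesis by linarith
    next
      case False
      then have "real t \<le> real A" by simp
      also have "\<dots> < r * real N0" using N0 r by (simp add: field_simps)
      also have "\<dots> \<le> r * real N" using N r by simp
      finally show ?thesis .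
    qed
    then show "norm (real (card {j \<in> {1..N}. fst (e j) = n0}) / real N - 0) < r"
      using N1 unfolding t_def[symmetric] by (simp add: field_simps)
  qed
qed

lemma increasing_listing_swap:
  assumes "increasing_listing F e"
  shows "increasing_listing (F \<circ> prod.swap) (prod.swap \<circ> e)"
proof -
  have "bij_betw prod.swap UNIV UNIV" by simp
  then show ?thesis using assms unfolding increasing_listing_def
    by (auto simp: comp_assoc intro: bij_betw_trans)
qed

text \<open>
  Cesaro's theorem for a rearrangement with repetitions: the terms not yet small come from
  finitely many values of \<open>x\<close>, each of density zero.
\<close>

lemma cesaro_null_along:
  fixes a :: "nat \<Rightarrow> real" and x :: "nat \<Rightarrow> nat"
  assumes a: "a \<longlonglongrightarrow> 0"
    and dens: "\<And>n. (\<lambda>N. real (card {j \<in> {1..N}. x j = n}) / real N) \<longlonglongrightarrow> 0"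
  shows "(\<lambda>N. 1 / real N * (\<Sum>j=1..N. a (x j))) \<longlonglongrightarrow> 0"
proof (rule LIMSEQ_I)
  fix r :: real assume r: "r > 0"
  obtain K where K: "\<And>n. n \<ge> K \<Longrightarrow> \<bar>a n\<bar> < r / 2"
    using LIMSEQ_D[OF a, of "r / 2"] r by auto
  define B where "B N = (\<Sum>n<K. \<bar>a n\<bar> * (real (card {j \<in> {1..N}. x j = n}) / real N))" for N
  have "B \<longlonglongrightarrow> (\<Sum>n<K. \<bar>a n\<bar> * 0)"
    unfolding B_def by (intro tendsto_intros dens)
  then have "B \<longlonglongrightarrow> 0" by simp
  from LIMSEQ_D[OF this, of "r / 2"] obtain N0 where "\<forall>N\<ge>N0. norm (B N - 0) < r / 2"
    using r by auto
  then have N0: "B N < r / 2" if "N \<ge> N0" for N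
    using that by force
  have pt: "\<bar>a (x j)\<bar> \<le> r / 2 + (\<Sum>n<K. \<bar>a n\<bar> * of_bool (x j = n))" for j
  proof (cases "x j < K")
    case True
    then have "(\<Sum>n<K. \<bar>a n\<bar> * of_bool (x j = n)) = \<bar>a (x j)\<bar>"
      by (simp add: of_bool_def if_distrib[of "\<lambda>u. _ * u"] cong: if_cong)
    then show ?thesis using r by simp
  next
    case False
    then have "\<bar>a (x j)\<bar> < r / 2" using K by simp
    then show ?thesis by (smt (verit) sum_nonneg abs_ge_zero mult_nonneg_nonneg of_bool_def)
  qed
  show "\<exists>no. \<forall>N\<ge>no. norm (1 / real N * (\<Sum>j=1..N. a (x j)) - 0) < r"
  proof (intro exI allI impI)
    fix N assume N: "N \<ge> max 1 N0"
    have "\<bar>\<Sum>j=1..N. a (x j)\<bar> \<le> (\<Sum>j=1..N. \<bar>a (x j)\<bar>)" by (rule sum_abs)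
    also have "\<dots> \<le> (\<Sum>j=1..N. r / 2 + (\<Sum>n<K. \<bar>a n\<bar> * of_bool (x j = n)))"
      by (intro sum_mono pt)
    also have "\<dots> = real N * (r / 2) + (\<Sum>n<K. \<Sum>j=1..N. \<bar>a n\<bar> * of_bool (x j = n))"
      by (simp only: sum.distrib sum.swap[of _ "{1..N}" "{..<K}"] sum_constant card_atLeastAtMost) simp
    also have "\<dots> = real N * (r / 2) + (\<Sum>n<K. \<bar>a n\<bar> * real (card {j \<in> {1..N}. x j = n}))"
      by (simp add: sum_distrib_left[symmetric] Int_def)
    also have "\<dots> = real N * (r / 2 + B N)"
      using N unfolding B_def by (simp add: distrib_left sum_distrib_left)
    also have "\<dots> < real N * r" using N0[of N] N by simp
    finally show "norm (1 / real N * (\<Sum>j=1..N. a (x j)) - 0) < r"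
      using N by (simp add: abs_mult field_simps)
  qed
qed

section \<open>The secular equation\<close>

text \<open>Substituting \<open>x = tan y\<close> turns the left-hand side into \<open>sin (2y) / 2\<close>.\<close>

lemma arctan_lower: "x / (1 + x\<^sup>2) \<le> arctan x" if "x \<ge> 0" for x :: real
proof -
  have "x / (1 + x\<^sup>2) = sin (arctan x) * cos (arctan x)"
    by (simp add: sin_arctan cos_arctan)
  also have "\<dots> = sin (2 * arctan x) / 2" by (simp add: sin_double)
  also have "\<dots> \<le> arctan x" using sin_x_le_x[of "2 * arctan x"] that by simp
  finally show ?thesis .
qed

text \<open>
  With \<open>y = k + 2 arctan (k/s)\<close> the cross-multiplied secular equation reads
  \<open>(k\<^sup>2 + s\<^sup>2) sin y = 0\<close>, and the bounds on \<open>k\<close> leave only one multiple of \<open>\<pi>\<close> for \<open>y\<close>.  Using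
  \<open>arctan (k/s)\<close> instead of \<open>\<pi>/2 - arctan (s/k)\<close> keeps \<open>y\<close> continuous at \<open>k = 0\<close>, which the
  intermediate value theorem needs when \<open>n = 0\<close>.
\<close>

lemma secular_iff:
  fixes s k :: real
  assumes s: "s > 0" and k: "real n * pi < k" "k < (real n + 1) * pi"
  shows "secular s k \<longleftrightarrow> k + 2 * arctan (k / s) = (real n + 1) * pi"
proof -
  have k0: "k > 0" using k(1) by (smt (verit) mult_nonneg_nonneg of_nat_0_le_iff pi_ge_zero)
  define y where "y = k + 2 * arctan (k / s)"
  have "arctan (k / s) > 0" using k0 s by simp
  then have y: "real n * pi < y" "y < (real n + 2) * pi"
    using k arctan_ubound[of "k / s"] unfolding y_def
    by (auto simp: algebra_simps simp del: zero_less_arctan_iff)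
  have sc: "sin (2 * arctan (k / s)) = 2 * s * k / (k\<^sup>2 + s\<^sup>2)"
    "cos (2 * arctan (k / s)) = (s\<^sup>2 - k\<^sup>2) / (k\<^sup>2 + s\<^sup>2)"
  proof -
    have p: "k\<^sup>2 + s\<^sup>2 > 0" using s by (simp add: add_nonneg_pos)
    have "sin (2 * arctan (k / s)) = 2 * ((k / s) / (1 + (k / s)\<^sup>2))"
      by (simp add: sin_double sin_arctan cos_arctan)
    also have "\<dots> = 2 * s * k / (k\<^sup>2 + s\<^sup>2)"
      using s p by (simp add: field_simps power2_eq_square)
    finally show "sin (2 * arctan (k / s)) = 2 * s * k / (k\<^sup>2 + s\<^sup>2)" .
    have "cos (2 * arctan (k / s)) = 1 / (1 + (k / s)\<^sup>2) - (k / s)\<^sup>2 / (1 + (k / s)\<^sup>2)"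
      by (simp only: cos_double sin_arctan cos_arctan power_divide[of _ "sqrt _"]) simp
    also have "1 + (k / s)\<^sup>2 = (k\<^sup>2 + s\<^sup>2) / s\<^sup>2"
      using s by (simp add: field_simps power2_eq_square)
    also have "1 / ((k\<^sup>2 + s\<^sup>2) / s\<^sup>2) - (k / s)\<^sup>2 / ((k\<^sup>2 + s\<^sup>2) / s\<^sup>2)
        = (s\<^sup>2 - k\<^sup>2) / (k\<^sup>2 + s\<^sup>2)"
      using s by (simp add: power_divide diff_divide_distrib)
    finally show "cos (2 * arctan (k / s)) = (s\<^sup>2 - k\<^sup>2) / (k\<^sup>2 + s\<^sup>2)" .
  qed
  have nz: "k\<^sup>2 + s\<^sup>2 \<noteq> 0" using s by simp
  have "(k\<^sup>2 + s\<^sup>2) * sin y = sin k * ((k\<^sup>2 + s\<^sup>2) * cos (2 * arctan (k / s)))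
      + cos k * ((k\<^sup>2 + s\<^sup>2) * sin (2 * arctan (k / s)))"
    unfolding y_def sin_add by (simp add: algebra_simps)
  also have "\<dots> = 2 * s * k * cos k - (k\<^sup>2 - s\<^sup>2) * sin k"
    by (simp only: sc times_divide_eq_right nonzero_mult_div_cancel_left[OF nz])
      (simp add: algebra_simps)
  finally have "(k\<^sup>2 + s\<^sup>2) * sin y = 2 * s * k * cos k - (k\<^sup>2 - s\<^sup>2) * sin k" .
  with nz have "sin y = 0 \<longleftrightarrow> (k\<^sup>2 - s\<^sup>2) * sin k = 2 * s * k * cos k"
    by (metis eq_iff_diff_eq_0 mult_eq_0_iff)
  moreover have "secular s k \<longleftrightarrow> (k\<^sup>2 - s\<^sup>2) * sin k = 2 * s * k * cos k"
  proof (cases "k = s")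
    case False
    have d: "k\<^sup>2 - s\<^sup>2 \<noteq> 0" using False k0 s by (simp add: power2_eq_iff)
    show ?thesis
    proof (cases "cos k = 0")
      case True
      then have "sin k \<noteq> 0" using sin_cos_squared_add[of k] by auto
      then show ?thesis using True d False k0 s unfolding secular_def tan_def by simp
    next
      case c: False
      show ?thesis using c d False unfolding secular_def tan_def by (simp add: field_simps)
    qed
  qed (simp add: secular_def)
  moreover have "sin y = 0 \<longleftrightarrow> y = (real n + 1) * pi"
  proof
    assume "sin y = 0"
    then obtain i :: int where i: "y = of_int i * pi" using sin_zero_iff_int2 by auto
    then have "real n < of_int i" "of_int i < real n + 2" using y by auto
    then have "i = int n + 1" by linarith
    then show "y = (real n + 1) * pi" using i by simp
  next
    assume "y = (real n + 1) * pi"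
    then have "y = real (Suc n) * pi" by (simp add: algebra_simps)
    then show "sin y = 0" by (simp only: sin_npi)
  qed
  ultimately show ?thesis unfolding y_def by simp
qed

text \<open>
  Existence by the intermediate value theorem and uniqueness by strict monotonicity in \<open>k\<close>
  make the definite description in \<open>robin_k\<close> meaningful.
\<close>

lemma robin_k_props:
  assumes s: "s > 0"
  shows "real n * pi < robin_k n s" "robin_k n s < (real n + 1) * pi"
    "robin_k n s + 2 * arctan (robin_k n s / s) = (real n + 1) * pi"
proof -
  define y where "y k = k + 2 * arctan (k / s)" for k
  have inc: "y k < y k'" if "k < k'" for k k'
    using that s unfolding y_def by (smt (verit) arctan_monotone divide_strict_right_mono)
  have "\<exists>k\<ge>real n * pi. k \<le> (real n + 1) * pi \<and> y k = (real n + 1) * pi"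
  proof (rule IVT')
    show "y (real n * pi) \<le> (real n + 1) * pi"
      unfolding y_def using arctan_ubound[of "real n * pi / s"] by (simp add: algebra_simps)
    show "(real n + 1) * pi \<le> y ((real n + 1) * pi)"
      unfolding y_def using s by simp
    show "continuous_on {real n * pi..(real n + 1) * pi} y"
      unfolding y_def using s by (intro continuous_intros) auto
  qed (simp add: algebra_simps)
  then obtain k where k: "real n * pi \<le> k" "k \<le> (real n + 1) * pi" "y k = (real n + 1) * pi" by blast
  have "k \<noteq> real n * pi"
    using k(3) arctan_ubound[of "k / s"] unfolding y_def by (auto simp: algebra_simps)
  moreover have "k \<noteq> (real n + 1) * pi"
    using k(3) s unfolding y_def by (auto simp: add_pos_nonneg)
  ultimately have k': "real n * pi < k" "k < (real n + 1) * pi" using k by auto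
  have "robin_k n s = (THE k. real n * pi < k \<and> k < (real n + 1) * pi \<and> secular s k)"
    using s unfolding robin_k_def by simp
  also have "\<dots> = k"
  proof (rule the_equality)
    show "real n * pi < k \<and> k < (real n + 1) * pi \<and> secular s k"
      using k' k(3) secular_iff[OF s k'] unfolding y_def by simp
    fix x assume x: "real n * pi < x \<and> x < (real n + 1) * pi \<and> secular s x"
    then have "y x = (real n + 1) * pi" using secular_iff[OF s] unfolding y_def by blast
    then show "x = k" using inc[of x k] inc[of k x] k(3) by linarith
  qed
  finally have eq: "robin_k n s = k" .
  show "real n * pi < robin_k n s" "robin_k n s < (real n + 1) * pi"
    "robin_k n s + 2 * arctan (robin_k n s / s) = (real n + 1) * pi"
    using eq k' k(3) unfolding y_def by auto
qed

lemma robin_k_pos: "s > 0 \<Longrightarrow> robin_k n s > 0"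
  using robin_k_props(1)[of s n] by (smt (verit) mult_nonneg_nonneg of_nat_0_le_iff pi_ge_zero)

lemma robin_k_bounds:
  assumes "s \<ge> 0"
  shows "real n * pi \<le> robin_k n s" "robin_k n s \<le> (real n + 1) * pi"
  using robin_k_props(1,2)[of s n] assms
  by (cases "s = 0"; simp add: robin_k_def algebra_simps)+

lemma robin_k_nonneg: "s \<ge> 0 \<Longrightarrow> robin_k n s \<ge> 0"
  by (rule order_trans[OF _ robin_k_bounds(1)]) auto

section \<open>One-dimensional gaps\<close>

definition interval_gap :: "real \<Rightarrow> nat \<Rightarrow> real" where
  "interval_gap s n = (robin_k n s)\<^sup>2 - (robin_k n 0)\<^sup>2"

lemma robin_k_arctan:
  assumes s: "s > 0"
  shows "robin_k n s - real n * pi = 2 * arctan (s / robin_k n s)"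
proof -
  have "arctan (robin_k n s / s) = pi / 2 - arctan (s / robin_k n s)"
    using arctan_inverse[of "s / robin_k n s"] s robin_k_pos[OF s, of n] by simp
  then show ?thesis using robin_k_props(3)[OF s, of n] by (simp add: algebra_simps)
qed

lemma interval_gap_eq:
  assumes s: "s > 0"
  shows "interval_gap s n = 2 * arctan (s / robin_k n s) * (robin_k n s + real n * pi)"
  unfolding interval_gap_def robin_k_arctan[OF s, symmetric]
  by (simp add: robin_k_def power2_eq_square algebra_simps)

lemma interval_gap_le:
  assumes s: "s > 0"
  shows "interval_gap s n \<le> 4 * s"
proof -
  let ?k = "robin_k n s"
  have k: "?k > 0" "real n * pi < ?k" using robin_k_pos[OF s] robin_k_props[OF s] by auto
  have "interval_gap s n \<le> 2 * (s / ?k) * (2 * ?k)"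
    unfolding interval_gap_eq[OF s] using k s arctan_le_self[of "s / ?k"]
    by (intro mult_mono) auto
  then show ?thesis using k by simp
qed

lemma interval_gap_ge_arctan:
  assumes s: "s > 0"
  shows "2 * arctan (s / robin_k n s) * robin_k n s \<le> interval_gap s n"
  unfolding interval_gap_eq[OF s] using s robin_k_pos[OF s, of n] by (intro mult_left_mono) auto

lemma interval_gap_nonneg: "s \<ge> 0 \<Longrightarrow> interval_gap s n \<ge> 0"
  unfolding interval_gap_def using power_mono[OF robin_k_bounds(1)[of s n], of 2]
  by (simp add: robin_k_def[of n 0])

text \<open>
  For \<open>s \<le> 1\<close> the argument \<open>s / k\<close> stays in \<open>[0, 1]\<close>, where \<open>arctan x \<ge> x / 2\<close>: if \<open>s > k\<close>,
  then \<open>k \<ge> 2 arctan (s/k) \<ge> \<pi>/2 > 1 \<ge> s\<close>, a contradiction.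
\<close>

lemma interval_gap_ge:
  assumes s: "s > 0" "s \<le> 1"
  shows "s \<le> interval_gap s n"
proof -
  let ?k = "robin_k n s"
  have k: "?k > 0" "real n * pi < ?k" using robin_k_pos[OF s(1)] robin_k_props[OF s(1)] by auto
  have "s \<le> ?k"
  proof (rule ccontr)
    assume "\<not> s \<le> ?k"
    then have "arctan 1 \<le> arctan (s / ?k)" using k by (intro arctan_monotone') simp
    then have "pi / 2 \<le> ?k - real n * pi" using robin_k_arctan[OF s(1), of n] by (simp add: arctan_one)
    moreover have "real n * pi \<ge> 0" by simp
    ultimately have "?k \<ge> pi / 2" by linarith
    then show False using \<open>\<not> s \<le> ?k\<close> s(2) pi_gt3 by simp
  qed
  then have x: "0 \<le> s / ?k" "(s / ?k)\<^sup>2 \<le> 1" using s k by (auto simp: power_le_one)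
  have "(s / ?k) / 2 \<le> (s / ?k) / (1 + (s / ?k)\<^sup>2)"
    using x by (intro divide_left_mono mult_pos_pos add_pos_nonneg) auto
  also have "\<dots> \<le> arctan (s / ?k)" using arctan_lower x by blast
  finally have "2 * ((s / ?k) / 2) * ?k \<le> 2 * arctan (s / ?k) * ?k"
    using k by (intro mult_right_mono mult_left_mono) auto
  then show ?thesis using interval_gap_ge_arctan[OF s(1), of n] k by simp
qed

text \<open>
  The lower bound \<open>arctan x \<ge> x / (1 + x\<^sup>2)\<close> and \<open>n\<pi> > k - \<pi>\<close> bound the gap from below by a function
  of \<open>k\<close> alone that tends to \<open>4s\<close>.
\<close>

lemma interval_gap_tendsto:
  assumes s: "s > 0"
  shows "interval_gap s \<longlonglongrightarrow> 4 * s"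
proof (rule tendsto_sandwich)
  let ?k = "\<lambda>n. robin_k n s"
  have kinf: "filterlim ?k at_top at_top"
  proof (rule filterlim_at_top_mono)
    show "filterlim (\<lambda>n. real n * pi) at_top at_top" by real_asymp
  qed (use robin_k_bounds(1)[of s] s in auto)
  have "((\<lambda>k. 2 * (s / k / (1 + (s / k)\<^sup>2)) * (2 * k - pi)) \<longlongrightarrow> 4 * s) at_top"
    using s by real_asymp
  then show "(\<lambda>n. 2 * (s / ?k n / (1 + (s / ?k n)\<^sup>2)) * (2 * ?k n - pi)) \<longlonglongrightarrow> 4 * s"
    by (rule filterlim_compose) (rule kinf)
  have "2 * (s / ?k n / (1 + (s / ?k n)\<^sup>2)) * (2 * ?k n - pi) \<le> interval_gap s n" if n: "n \<ge> 1" for n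
  proof -
    have k: "?k n > 0" "?k n < (real n + 1) * pi" using robin_k_pos[OF s] robin_k_props[OF s] by auto
    have "2 * (s / ?k n / (1 + (s / ?k n)\<^sup>2)) * (2 * ?k n - pi)
        \<le> 2 * (s / ?k n / (1 + (s / ?k n)\<^sup>2)) * (?k n + real n * pi)"
      using k s by (intro mult_left_mono) (auto simp: algebra_simps)
    also have "\<dots> \<le> interval_gap s n" unfolding interval_gap_eq[OF s]
      using k s arctan_lower[of "s / ?k n"] by (intro mult_right_mono mult_left_mono) auto
    finally show ?thesis .
  qed
  then show "\<forall>\<^sub>F n in sequentially. 2 * (s / ?k n / (1 + (s / ?k n)\<^sup>2)) * (2 * ?k n - pi) \<le> interval_gap s n"
    using eventually_sequentially by blast
  show "\<forall>\<^sub>F n in sequentially. interval_gap s n \<le> 4 * s" using interval_gap_le[OF s] by simp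
qed simp

section \<open>Eigenvalues of the rectangle\<close>

lemma robin_k_sq_mono:
  assumes "s \<ge> 0"
  shows "mono (\<lambda>n. (robin_k n s)\<^sup>2)"
proof (rule incseq_SucI)
  fix n
  have "robin_k n s \<le> robin_k (Suc n) s"
    using robin_k_bounds(2)[OF assms, of n] robin_k_bounds(1)[OF assms, of "Suc n"]
    by (simp add: algebra_simps)
  then show "(robin_k n s)\<^sup>2 \<le> (robin_k (Suc n) s)\<^sup>2"
    using robin_k_nonneg[OF assms] by (rule power_mono)
qed

text \<open>Since \<open>n\<pi> \<le> k\<^sub>n \<le> (n+1)\<pi>\<close>, the difference grows like \<open>3/4 (b\<pi>)\<^sup>2\<close>.\<close>

lemma robin_k_sq_growth:
  assumes s: "s \<ge> 0" 
  shows "filterlim (\<lambda>b. (robin_k b s)\<^sup>2 - (robin_k (b div 2) s)\<^sup>2) at_top at_top"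
proof (rule filterlim_at_top_mono)
  have "filterlim (\<lambda>b. real b * (3/4 * real b - 1) - 1) at_top sequentially"
    by real_asymp
  then have "filterlim (\<lambda>b. pi\<^sup>2 * (real b * (3/4 * real b - 1) - 1)) at_top sequentially"
    by (intro filterlim_tendsto_pos_mult_at_top[OF tendsto_const]) auto
  then show "filterlim (\<lambda>b. (real b * pi)\<^sup>2 - ((real b / 2 + 1) * pi)\<^sup>2) at_top at_top"
    by (rule back_subst[where P = "\<lambda>u. filterlim u at_top at_top"])
      (simp add: fun_eq_iff power2_eq_square field_simps)
  have "(real b * pi)\<^sup>2 - ((real b / 2 + 1) * pi)\<^sup>2 \<le> (robin_k b s)\<^sup>2 - (robin_k (b div 2) s)\<^sup>2" for b
  proof -
    have "real (b div 2) \<le> real b / 2" by linarith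
    then have "(real (b div 2) + 1) * pi \<le> (real b / 2 + 1) * pi" by (intro mult_right_mono) auto
    then have "robin_k (b div 2) s \<le> (real b / 2 + 1) * pi"
      using robin_k_bounds(2)[OF s, of "b div 2"] by (rule order_trans[rotated])
    then have "(robin_k (b div 2) s)\<^sup>2 \<le> ((real b / 2 + 1) * pi)\<^sup>2"
      using robin_k_nonneg[OF s] by (rule power_mono)
    moreover have "(real b * pi)\<^sup>2 \<le> (robin_k b s)\<^sup>2"
      using robin_k_bounds(1)[OF s, of b] by (intro power_mono) auto
    ultimately show ?thesis by simp
  qed
  then show "\<forall>\<^sub>F b in at_top. (real b * pi)\<^sup>2 - ((real b / 2 + 1) * pi)\<^sup>2
      \<le> (robin_k b s)\<^sup>2 - (robin_k (b div 2) s)\<^sup>2" by simp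
qed

lemma robin_k_sq_at_top:
  assumes s: "s \<ge> 0"
  shows "filterlim (\<lambda>n. (robin_k n s)\<^sup>2) at_top at_top"
  by (rule filterlim_at_top_mono[OF robin_k_sq_growth[OF s]]) simp

lemma finite_sublevel:
  fixes f h :: "nat \<Rightarrow> real"
  assumes f: "filterlim f at_top at_top" "\<And>n. f n \<ge> 0" and h: "filterlim h at_top at_top" "\<And>n. h n \<ge> 0"
  shows "finite {(n, m). f n + h m \<le> R}"
proof -
  have fin: "finite {n. g n \<le> R}" if g: "filterlim g at_top at_top" for g :: "nat \<Rightarrow> real"
  proof -
    obtain N where "\<And>n. n \<ge> N \<Longrightarrow> g n > R"
      using filterlim_at_top_dense[THEN iffD1, OF g, rule_format, of R]
      unfolding eventually_at_top_linorder by blast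
    then have "{n. g n \<le> R} \<subseteq> {..<N}" by (auto simp: not_le[symmetric])
    then show ?thesis using finite_subset by blast
  qed
  have "{(n, m). f n + h m \<le> R} \<subseteq> {n. f n \<le> R} \<times> {m. h m \<le> R}"
    using f(2) h(2) by auto (smt (verit))+
  then show ?thesis using fin[OF f(1)] fin[OF h(1)] finite_subset by blast
qed

definition robin_listing :: "real \<Rightarrow> real \<Rightarrow> nat \<Rightarrow> nat \<times> nat" where
  "robin_listing L s = (SOME e. increasing_listing (\<lambda>p. Lambda L p s) e)"

lemma robin_listing:
  assumes L: "L > 0" and s: "s \<ge> 0"
  shows "increasing_listing (\<lambda>p. Lambda L p s) (robin_listing L s)"
proof -
  have "filterlim (\<lambda>m. 1 / L\<^sup>2 * (robin_k m (s * L))\<^sup>2) at_top at_top"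
    using L s by (intro filterlim_tendsto_pos_mult_at_top[OF tendsto_const] robin_k_sq_at_top) auto
  then have "finite {(n, m). (robin_k n s)\<^sup>2 + 1 / L\<^sup>2 * (robin_k m (s * L))\<^sup>2 \<le> R}" for R
    by (intro finite_sublevel robin_k_sq_at_top s) auto
  then have "\<exists>e. increasing_listing (\<lambda>p. Lambda L p s) e"
    by (intro increasing_listing_exists) (simp add: Lambda_def case_prod_unfold)
  then show ?thesis unfolding robin_listing_def by (rule someI_ex)
qed

lemma robin_eigenvalue_listing: "robin_eigenvalue L j s = Lambda L (robin_listing L s j) s"
  unfolding robin_eigenvalue_def robin_listing_def ..

lemma Lambda_gap: "Lambda L (n, m) s - Lambda L (n, m) 0 = interval_gap s n + interval_gap (s * L) m / L\<^sup>2"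
  unfolding Lambda_def interval_gap_def by (simp add: diff_divide_distrib)

lemma RN_gap_ge:
  assumes L: "L > 0" and s: "s > 0" and j: "j \<ge> 1"
    and d: "\<And>n m. d \<le> interval_gap s n + interval_gap (s * L) m / L\<^sup>2"
  shows "d \<le> RN_gap L j s"
proof -
  have "Lambda L (robin_listing L 0 j) 0 + d \<le> Lambda L (robin_listing L s j) s"
  proof (rule increasing_listing_compare[OF robin_listing[OF L] robin_listing[OF L]])
    fix p show "Lambda L p 0 + d \<le> Lambda L p s"
      using Lambda_gap[of L "fst p" "snd p" s] d[of "fst p" "snd p"] by simp
  qed (use s j in auto)
  then show ?thesis unfolding RN_gap_def robin_eigenvalue_listing by simp
qed

lemma RN_gap_le:
  assumes L: "L > 0" and s: "s > 0" and j: "j \<ge> 1"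
  shows "RN_gap L j s \<le> 4 * (1 + L) / L * s"
proof -
  have G: "4 * (1 + L) / L * s = 4 * s + 4 * (s * L) / L\<^sup>2"
    using L by (simp add: field_simps power2_eq_square)
  have "Lambda L (robin_listing L s j) s + (- (4 * (1 + L) / L * s)) \<le> Lambda L (robin_listing L 0 j) 0"
  proof (rule increasing_listing_compare[OF robin_listing[OF L] robin_listing[OF L]])
    fix p :: "nat \<times> nat"
    have "interval_gap (s * L) (snd p) / L\<^sup>2 \<le> 4 * (s * L) / L\<^sup>2"
      using interval_gap_le[of "s * L" "snd p"] s L by (intro divide_right_mono) auto
    then have "interval_gap s (fst p) + interval_gap (s * L) (snd p) / L\<^sup>2 \<le> 4 * (1 + L) / L * s"
      using interval_gap_le[OF s, of "fst p"] G by linarith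
    then show "Lambda L p s + (- (4 * (1 + L) / L * s)) \<le> Lambda L p 0"
      using Lambda_gap[of L "fst p" "snd p" s] by simp
  qed (use s j in auto)
  then show ?thesis unfolding RN_gap_def robin_eigenvalue_listing by simp
qed

text \<open>
  Trial-set argument: the first \<open>N\<close> pairs of the Robin ordering are an admissible choice in
  the minimisation that characterises the sum of the first \<open>N\<close> Neumann eigenvalues.
\<close>

lemma sum_RN_gap_ge:
  assumes L: "L > 0" and s: "s > 0"
  shows "(\<Sum>j=1..N. interval_gap s (fst (robin_listing L s j)) + interval_gap (s * L) (snd (robin_listing L s j)) / L\<^sup>2)
    \<le> (\<Sum>j=1..N. RN_gap L j s)"
proof -
  let ?e = "robin_listing L s"
  have inj: "inj_on ?e {1..N}" using robin_listing[OF L, of s] s by (intro increasing_listing_inj) auto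
  have "(\<Sum>j=1..N. Lambda L (robin_listing L 0 j) 0) \<le> sum (\<lambda>p. Lambda L p 0) (?e ` {1..N})"
    using robin_listing[OF L, of 0] card_image[OF inj] by (intro increasing_listing_sum_le) auto
  also have "\<dots> = (\<Sum>j=1..N. Lambda L (?e j) 0)" using sum.reindex[OF inj] by simp
  finally show ?thesis
    using Lambda_gap[of L "fst (?e _)" "snd (?e _)" s, symmetric]
    unfolding RN_gap_def robin_eigenvalue_listing by (simp add: sum_subtractf)
qed

lemma robin_listing_densities:
  assumes L: "L > 0" and s: "s > 0"
  shows "(\<lambda>N. real (card {j \<in> {1..N}. fst (robin_listing L s j) = n}) / real N) \<longlonglongrightarrow> 0"
    and "(\<lambda>N. real (card {j \<in> {1..N}. snd (robin_listing L s j) = n}) / real N) \<longlonglongrightarrow> 0"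
proof -
  let ?f = "\<lambda>n. (robin_k n s)\<^sup>2" and ?h = "\<lambda>m. 1 / L\<^sup>2 * (robin_k m (s * L))\<^sup>2"
  have e: "increasing_listing (\<lambda>p. Lambda L p s) (robin_listing L s)"
    using robin_listing[OF L] s by simp
  have sL: "s \<ge> 0" "s * L \<ge> 0" using s L by auto
  have f: "mono ?f" "filterlim (\<lambda>b. ?f b - ?f (b div 2)) at_top at_top"
    using robin_k_sq_mono robin_k_sq_growth sL by auto
  have "filterlim (\<lambda>b. 1 / L\<^sup>2 * ((robin_k b (s * L))\<^sup>2 - (robin_k (b div 2) (s * L))\<^sup>2)) at_top at_top"
    using L sL by (intro filterlim_tendsto_pos_mult_at_top[OF tendsto_const] robin_k_sq_growth) auto
  then have h: "filterlim (\<lambda>b. ?h b - ?h (b div 2)) at_top at_top"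
    by (simp only: right_diff_distrib)
  have hm: "mono ?h"
    using robin_k_sq_mono[OF sL(2)] by (auto simp: mono_def intro!: divide_right_mono)
  show "(\<lambda>N. real (card {j \<in> {1..N}. fst (robin_listing L s j) = n}) / real N) \<longlonglongrightarrow> 0"
    by (rule column_density_zero[OF e _ hm h, of ?f]) (simp add: Lambda_def)
  have "(\<lambda>N. real (card {j \<in> {1..N}. fst ((prod.swap \<circ> robin_listing L s) j) = n}) / real N) \<longlonglongrightarrow> 0"
    by (rule column_density_zero[OF increasing_listing_swap[OF e] _ f, of ?h]) (simp add: Lambda_def)
  then show "(\<lambda>N. real (card {j \<in> {1..N}. snd (robin_listing L s j) = n}) / real N) \<longlonglongrightarrow> 0"
    by simp
qed

text \<open>
  The deviations \<open>a\<close> and \<open>b\<close> of the horizontal and vertical gaps from their limits average out,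
  because every row and every column is negligible; the upper bound holds termwise.
\<close>

lemma mean_RN_gap_eq:
  assumes L: "L > 0" and s: "s > 0"
  shows "mean_RN_gap L s = 4 * (1 + L) / L * s"
proof -
  let ?G = "4 * (1 + L) / L * s" and ?e = "robin_listing L s"
  define a where "a n = interval_gap s n - 4 * s" for n
  define b where "b m = interval_gap (s * L) m / L\<^sup>2 - 4 * (s * L) / L\<^sup>2" for m
  have sL: "s * L > 0" using s L by simp
  have "(\<lambda>n. interval_gap s n - 4 * s) \<longlonglongrightarrow> 4 * s - 4 * s" by (intro tendsto_intros interval_gap_tendsto s)
  then have a: "a \<longlonglongrightarrow> 0" unfolding a_def by simp
  have "(\<lambda>m. interval_gap (s * L) m / L\<^sup>2 - 4 * (s * L) / L\<^sup>2) \<longlonglongrightarrow> 4 * (s * L) / L\<^sup>2 - 4 * (s * L) / L\<^sup>2"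
    using L by (intro tendsto_intros interval_gap_tendsto sL) auto
  then have b: "b \<longlonglongrightarrow> 0" unfolding b_def by simp
  have G: "?G = 4 * s + 4 * (s * L) / L\<^sup>2" using L by (simp add: field_simps power2_eq_square)
  have lim: "(\<lambda>N. 1 / real N * (\<Sum>j=1..N. RN_gap L j s)) \<longlonglongrightarrow> ?G"
  proof (rule tendsto_sandwich)
    let ?lo = "\<lambda>N. ?G + 1 / real N * (\<Sum>j=1..N. a (fst (?e j))) + 1 / real N * (\<Sum>j=1..N. b (snd (?e j)))"
    have "?lo \<longlonglongrightarrow> ?G + 0 + 0"
      by (intro tendsto_add tendsto_const cesaro_null_along a b robin_listing_densities[OF L s])
    then show "?lo \<longlonglongrightarrow> ?G" by simp
    have "?lo N \<le> 1 / real N * (\<Sum>j=1..N. RN_gap L j s)" if N: "N \<ge> 1" for N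
    proof -
      have "(\<Sum>j=1..N. ?G + a (fst (?e j)) + b (snd (?e j))) \<le> (\<Sum>j=1..N. RN_gap L j s)"
        using sum_RN_gap_ge[OF L s, of N] unfolding G a_def b_def by (simp add: algebra_simps)
      then have "1 / real N * (\<Sum>j=1..N. ?G + a (fst (?e j)) + b (snd (?e j)))
          \<le> 1 / real N * (\<Sum>j=1..N. RN_gap L j s)" by (intro mult_left_mono) auto
      moreover have "1 / real N * (\<Sum>j=1..N. ?G + a (fst (?e j)) + b (snd (?e j))) = ?lo N"
        using N by (simp only: sum.distrib distrib_left) simp
      ultimately show ?thesis by simp
    qed
    then show "\<forall>\<^sub>F N in sequentially. ?lo N \<le> 1 / real N * (\<Sum>j=1..N. RN_gap L j s)"
      using eventually_sequentially by blast
    have "1 / real N * (\<Sum>j=1..N. RN_gap L j s) \<le> ?G" if N: "N \<ge> 1" for N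
    proof -
      have "(\<Sum>j=1..N. RN_gap L j s) \<le> real N * ?G"
        using sum_bounded_above[of "{1..N}" "\<lambda>j. RN_gap L j s" ?G] RN_gap_le[OF L s] by simp
      then have "1 / real N * (\<Sum>j=1..N. RN_gap L j s) \<le> 1 / real N * (real N * ?G)"
        by (intro mult_left_mono) auto
      then show ?thesis using N by simp
    qed
    then show "\<forall>\<^sub>F N in sequentially. 1 / real N * (\<Sum>j=1..N. RN_gap L j s) \<le> ?G"
      using eventually_sequentially by blast
  qed simp
  then show ?thesis unfolding mean_RN_gap_def by (rule limI)
qed

theorem theorem1p4:
  "\<exists>C c :: real. C > c \<and> c > 0 \<and>
     (\<forall>L :: real. L > 0 \<longrightarrow>
        (\<forall>\<sigma> > 0. \<forall>j \<ge> 1. RN_gap L j \<sigma> \<le> C * mean_RN_gap L \<sigma>) \<and>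
        (\<forall>\<sigma> \<in> {0<..1}. \<forall>j \<ge> 1. RN_gap L j \<sigma> \<ge> c * mean_RN_gap L \<sigma>))"
proof (rule exI[of _ 1], rule exI[of _ "1/8"], intro conjI allI impI ballI)
  fix L s :: real and j :: nat
  assume L: "L > 0" and "s > 0" "j \<ge> 1"
  then show "RN_gap L j s \<le> 1 * mean_RN_gap L s"
    using RN_gap_le mean_RN_gap_eq by simp
next
  fix L s :: real and j :: nat
  assume L: "L > 0" and "s \<in> {0<..1}" and j: "j \<ge> 1"
  then have s: "s > 0" "s \<le> 1" by auto
  show "RN_gap L j s \<ge> 1/8 * mean_RN_gap L s"
    unfolding mean_RN_gap_eq[OF L s(1)]
  proof (rule RN_gap_ge[OF L s(1) j])
    fix n m
    show "1/8 * (4 * (1 + L) / L * s) \<le> interval_gap s n + interval_gap (s * L) m / L\<^sup>2"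
    \<comment> \<open>The shorter side dominates; along it the rescaled Robin parameter is at most \<open>1\<close>.\<close>
    proof (cases "L \<ge> 1")
      case True
      have "1/8 * (4 * (1 + L) / L * s) \<le> s" using True s by (simp add: field_simps)
      also have "\<dots> \<le> interval_gap s n" using interval_gap_ge s by simp
      also have "\<dots> \<le> interval_gap s n + interval_gap (s * L) m / L\<^sup>2" using interval_gap_nonneg[of "s * L" m] s L by simp
      finally show ?thesis .
    next
      case False
      then have "s * L \<le> 1" using s L by (simp add: mult_le_one)
      have "1/8 * (4 * (1 + L) / L * s) \<le> s * L / L\<^sup>2"
        using False s L by (simp add: field_simps power2_eq_square)
      also have "\<dots> \<le> interval_gap (s * L) m / L\<^sup>2"
        using interval_gap_ge[of "s * L" m] s L \<open>s * L \<le> 1\<close> by (intro divide_right_mono) auto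
      also have "\<dots> \<le> interval_gap s n + interval_gap (s * L) m / L\<^sup>2" using interval_gap_nonneg[of s n] s by simp
      finally show ?thesis .
    qed
  qed
qed auto

end
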